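(* Let $\mathbb{F}$ be a field, $A\in\mathbb{F}^{n\times n}$ with columns $a_1,\dots,a_n$, and suppose $Z=[k]$ is a zero forcing set of $A$. Let $r=\operatorname{rank}(A)$, $A'=[a_1\ \cdots\ a_k]$, $A''=[a_{k+1}\ \cdots\ a_n]$, and write $A=[A'_1\ A'_2\ A'']$ where $A'_1=[a_1\ \cdots\ a_p]$, $A'_2=[a_{p+1}\ \cdots\ a_k]$, $p=r-(n-k)$, $\operatorname{rank}(A'_1)=p$ and $\operatorname{rank}([A'_1\ A''])=r$. Let $M\in\mathbb{F}^{k\times n}$ satisfy $MA''=0$ and $\operatorname{rank}(MA'_1)=\operatorname{rank}(A'_1)$. Let $b\in\mathbb{F}^n$ be such that $Ax=b$ has a solution. If $y\in\mathbb{F}^k$ satisfies $MA'y=Mb$, then there exists $x\in\mathbb{F}^n$ with $Ax=b$ and $x_Z=y$.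
   Context: Zero forcing: for the directed graph on $V=[n]$ with an arc $(u,v)$ iff $u\neq v$ and $A_{u,v}\neq0$, start from a blue set $Z$; a blue vertex with exactly one non-blue out-neighbour $u$ forces $u$ (colours it blue); $Z$ is a zero forcing set of $A$ if this eventually colours all vertices blue. $x_Z$ denotes the restriction of $x$ to the coordinates in $Z=[k]$. *)

theory Defs
  imports "Jordan_Normal_Form.DL_Rank"
begin

(* Vertices are 0-based: [n] is {0..<n}; row u carries the out-arcs of u. *)
definition mat_arcs :: "'a::zero mat \<Rightarrow> nat rel" where
  "mat_arcs A =
     {(u, v). u < dim_row A \<and> v < dim_col A \<and> u \<noteq> v \<and> A $$ (u, v) \<noteq> 0}"

(* E `` {v} - B is the set of non-blue out-neighbours of v when B is the blue set. *)
definition force_step :: "nat rel \<Rightarrow> nat set rel" where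
  "force_step E = {(B, insert u B) | B u v. v \<in> B \<and> E `` {v} - B = {u}}"

definition zero_forcing_set :: "'a::zero mat \<Rightarrow> nat set \<Rightarrow> bool" where
  "zero_forcing_set A Z \<longleftrightarrow>
     Z \<subseteq> {0..<dim_row A} \<and> (Z, {0..<dim_row A}) \<in> (force_step (mat_arcs A))\<^sup>*"

definition cols_mat :: "'a mat \<Rightarrow> nat list \<Rightarrow> 'a mat" where
  "cols_mat A js = mat_of_cols (dim_row A) (map (col A) js)"

end

theory Submission
  imports Defs
begin

text \<open>
  Let x0 be a solution with first block x1 and last block x2, and put d = y - x1, so that
  M A' d = 0. Since [A'1 A''] has the rank of A, it has the same column space, hence
  A' d = A'1 u + A'' w for some u and w. Applying M kills A'' and leaves M A'1 u = 0, and
  M A'1 has full column rank, so u = 0. Thus A' d = A'' w, and the vector with blocks y and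
  x2 - w is the required solution.
\<close>

text \<open>An element of \<open>S\<close> outside \<open>span U\<close> could be adjoined to
  \<open>U\<close> without losing independence, against maximality.\<close>

lemma (in vectorspace) span_maximal_lin_indpt:
  assumes S: "S \<subseteq> carrier V" and fin: "finite S"
    and U: "maximal U (\<lambda>T. T \<subseteq> S \<and> lin_indpt T)"
  shows "span U = span S"
proof
  have US: "U \<subseteq> S" and li: "lin_indpt U"
    using U by (auto simp: maximal_def)
  have UV: "U \<subseteq> carrier V" and finU: "finite U"
    using US S fin by (auto intro: finite_subset)
  show "span U \<subseteq> span S"
    by (rule span_is_monotone[OF US])
  have "S \<subseteq> span U"
  proof
    fix s assume s: "s \<in> S"
    show "s \<in> span U"
    proof (rule ccontr)
      assume not_span: "s \<notin> span U"
      have "s \<notin> U"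
        using not_span span_mem[OF UV] by blast
      moreover have "lin_indpt (insert s U)"
        using lin_dep_iff_in_span[OF UV li _ \<open>s \<notin> U\<close>] s S not_span by auto
      then have "insert s U = U"
        using U US s by (auto simp: maximal_def)
      ultimately show False by blast
    qed
  qed
  then show "span S \<subseteq> span U"
    by (intro span_is_subset span_is_submodule UV)
qed

text \<open>A maximal independent set of columns of \<open>B\<close> extends to a maximal one for
  \<open>A\<close>. Rank counts either set, so equal ranks make the two sets coincide, and this
  common set spans both column spaces.\<close>

lemma (in vec_space) col_space_eq_if_rank_eq:
  assumes A: "A \<in> carrier_mat n nc" and B: "B \<in> carrier_mat n nc'"
    and sub: "set (cols B) \<subseteq> set (cols A)" and rank: "rank B = rank A"
  shows "col_space B = col_space A"
proof -
  have cA: "set (cols A) \<subseteq> carrier_vec n" and cB: "set (cols B) \<subseteq> carrier_vec n"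
    using A B cols_dim by blast+
  obtain S where S: "maximal S (\<lambda>T. T \<subseteq> set (cols B) \<and> lin_indpt T)"
    using maximal_exists_superset[of "set (cols B)" "\<lambda>T. T \<subseteq> set (cols B) \<and> lin_indpt T" "{}"]
    by (auto simp: lin_dep_def)
  then have "S \<subseteq> set (cols A) \<and> lin_indpt S"
    using sub by (auto simp: maximal_def)
  then obtain U where U: "maximal U (\<lambda>T. T \<subseteq> set (cols A) \<and> lin_indpt T)"
    and SU: "S \<subseteq> U" and finU: "finite U"
    using maximal_exists_superset[of "set (cols A)" "\<lambda>T. T \<subseteq> set (cols A) \<and> lin_indpt T" S]
    by auto
  have "card S = card U"
    using rank rank_card_indpt[OF A U] rank_card_indpt[OF B S] by simp
  then have "S = U"
    using SU finU by (simp add: card_subset_eq)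
  then show ?thesis
    using span_maximal_lin_indpt[OF _ _ U] span_maximal_lin_indpt[OF _ _ S] cA cB
    by (simp add: col_space_def)
qed

text \<open>Rank is the size of an independent subset of the set of columns, where repeated columns
  collapse; reaching \<open>nc\<close> leaves no room for a repetition.\<close>

lemma (in vec_space) full_rank_distinct_cols:
  assumes A: "A \<in> carrier_mat n nc" and rank: "rank A = nc"
  shows "distinct (cols A)"
proof -
  obtain S where S: "maximal S (\<lambda>T. T \<subseteq> set (cols A) \<and> lin_indpt T)"
    using maximal_exists_superset[of "set (cols A)" "\<lambda>T. T \<subseteq> set (cols A) \<and> lin_indpt T" "{}"]
    by (auto simp: lin_dep_def)
  have "nc \<le> card (set (cols A))"
    using rank rank_card_indpt[OF A S] S by (auto simp: maximal_def intro: card_mono)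
  then show ?thesis
    using A card_length[of "cols A"] by (intro card_distinct) auto
qed

text \<open>A nonzero kernel vector would be a linear dependence among the columns. Since dependence
  is a property of sets, the columns must first be known to be distinct.\<close>

lemma (in vec_space) full_rank_mult_vec_eq_0:
  assumes A: "A \<in> carrier_mat n nc" and rank: "rank A = nc"
    and v: "v \<in> carrier_vec nc" and Av: "A *\<^sub>v v = 0\<^sub>v n"
  shows "v = 0\<^sub>v nc"
proof (rule ccontr)
  note dist = full_rank_distinct_cols[OF A rank]
  assume "v \<noteq> 0\<^sub>v nc"
  from lin_depI[OF A v this Av dist] full_rank_lin_indpt[OF A rank dist]
  show False by contradiction
qed

lemma cols_mat_carrier: "A \<in> carrier_mat n m \<Longrightarrow> cols_mat A js \<in> carrier_mat n (length js)"
  by (auto simp: cols_mat_def)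

lemma cols_mat_upt: "A \<in> carrier_mat n m \<Longrightarrow> cols_mat A [0..<m] = A"
  unfolding cols_mat_def by (metis carrier_matD cols_def mat_of_cols_cols)

lemma set_cols_cols_mat: "set (cols (cols_mat A js)) = col A ` set js"
proof -
  have "set (map (col A) js) \<subseteq> carrier_vec (dim_row A)" by auto
  then show ?thesis
    unfolding cols_mat_def by (subst cols_mat_of_cols) simp_all
qed

text \<open>Block multiplication: each row of the joined matrix is a concatenation, and its scalar
  product splits accordingly. It serves to split both \<open>A\<close> and
  \<open>[A'1 A'']\<close>.\<close>

lemma cols_mat_append_mult_vec:
  fixes A :: "'a::comm_semiring_0 mat"
  assumes A: "A \<in> carrier_mat n m"
    and u: "u \<in> carrier_vec (length ks)" and v: "v \<in> carrier_vec (length js)"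
  shows "cols_mat A (ks @ js) *\<^sub>v (u @\<^sub>v v) = cols_mat A ks *\<^sub>v u + cols_mat A js *\<^sub>v v"
proof (rule eq_vecI)
  fix i assume "i < dim_vec (cols_mat A ks *\<^sub>v u + cols_mat A js *\<^sub>v v)"
  then have i: "i < n" using A by (auto simp: cols_mat_def)
  have row: "row (cols_mat A ls) i = vec (length ls) (\<lambda>t. col A (ls ! t) $ i)" for ls
    using i A by (intro eq_vecI) (auto simp: cols_mat_def mat_of_cols_index)
  have "row (cols_mat A (ks @ js)) i = row (cols_mat A ks) i @\<^sub>v row (cols_mat A js) i"
    unfolding row by (intro eq_vecI) (auto simp: nth_append)
  moreover have rc: "row (cols_mat A ls) i \<in> carrier_vec (length ls)" for ls
    by (simp add: row)
  ultimately have "row (cols_mat A (ks @ js)) i \<bullet> (u @\<^sub>v v)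
      = row (cols_mat A ks) i \<bullet> u + row (cols_mat A js) i \<bullet> v"
    using scalar_prod_append[OF rc rc u v] by simp
  then show "(cols_mat A (ks @ js) *\<^sub>v (u @\<^sub>v v)) $ i = (cols_mat A ks *\<^sub>v u + cols_mat A js *\<^sub>v v) $ i"
    using i cols_mat_carrier[OF A, of ks] cols_mat_carrier[OF A, of js]
      cols_mat_carrier[OF A, of "ks @ js"] by simp
qed (simp add: cols_mat_def)

theorem theorem4:
  fixes A A' A'1 A'' M :: "'a::field mat" and b y :: "'a vec" and n k r p :: nat
  assumes A: "A \<in> carrier_mat n n"
    and k: "k \<le> n"
    and zf: "zero_forcing_set A {0..<k}"
    and r: "r = vec_space.rank n A"
    and p: "int p = int r - int (n - k)"
    and A': "A' = cols_mat A [0..<k]"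
    and A'1: "A'1 = cols_mat A [0..<p]"
    and A'': "A'' = cols_mat A [k..<n]"
    and rank_A'1: "vec_space.rank n A'1 = p"
    and rank_A'1_A'': "vec_space.rank n (cols_mat A ([0..<p] @ [k..<n])) = r"
    and M: "M \<in> carrier_mat k n"
    and M_A'': "M * A'' = 0\<^sub>m k (n - k)"
    and rank_M_A'1: "vec_space.rank k (M * A'1) = vec_space.rank n A'1"
    and b: "b \<in> carrier_vec n"
    and solvable: "\<exists>x \<in> carrier_vec n. A *\<^sub>v x = b"
    and y: "y \<in> carrier_vec k"
    and M_y: "(M * A') *\<^sub>v y = M *\<^sub>v b"
  shows "\<exists>x \<in> carrier_vec n. A *\<^sub>v x = b \<and> vec_first x k = y"
proof -
  define C where "C = cols_mat A ([0..<p] @ [k..<n])"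
  \<comment> \<open>From \<open>r \<le> n\<close> and the integer equation for \<open>p\<close>,
    where no truncation occurs, one gets \<open>p \<le> k\<close>. Hence the columns selected for
    \<open>C\<close> all occur in \<open>A\<close>.\<close>
  have "r \<le> n"
    using vec_space.rank_le_nc[OF A] r by simp
  then have pk: "p \<le> k" using p k by linarith
  have A'c: "A' \<in> carrier_mat n k" and A1c: "A'1 \<in> carrier_mat n p"
    and A2c: "A'' \<in> carrier_mat n (n - k)" and Cc: "C \<in> carrier_mat n (p + (n - k))"
    unfolding A' A'1 A'' C_def
    using cols_mat_carrier[OF A, of "[0..<k]"] cols_mat_carrier[OF A, of "[0..<p]"]
      cols_mat_carrier[OF A, of "[k..<n]"] cols_mat_carrier[OF A, of "[0..<p] @ [k..<n]"]
    by simp_all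
  have A_split: "A *\<^sub>v (u @\<^sub>v w) = A' *\<^sub>v u + A'' *\<^sub>v w"
    if "u \<in> carrier_vec k" "w \<in> carrier_vec (n - k)" for u w
    using cols_mat_append_mult_vec[OF A, of u "[0..<k]" w "[k..<n]"] that
      cols_mat_upt[OF A] upt_add_eq_append[of 0 k "n - k"] k
    by (simp add: A' A'')
  have C_split: "C *\<^sub>v (u @\<^sub>v w) = A'1 *\<^sub>v u + A'' *\<^sub>v w"
    if "u \<in> carrier_vec p" "w \<in> carrier_vec (n - k)" for u w
    using cols_mat_append_mult_vec[OF A, of u "[0..<p]" w "[k..<n]"] that
    by (simp add: A'1 A'' C_def)
  have M2: "M *\<^sub>v (A'' *\<^sub>v w) = 0\<^sub>v k" if "w \<in> carrier_vec (n - k)" for w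
    unfolding assoc_mult_mat_vec[OF M A2c that, symmetric] M_A''
    using that by (intro eq_vecI) auto

  obtain x0 where x0: "x0 \<in> carrier_vec n" and Ax0: "A *\<^sub>v x0 = b"
    using solvable by blast
  define x1 where "x1 = vec_first x0 k"
  define x2 where "x2 = vec_last x0 (n - k)"
  have x1: "x1 \<in> carrier_vec k" and x2: "x2 \<in> carrier_vec (n - k)"
    by (auto simp: x1_def x2_def)
  have x0_split: "x0 = x1 @\<^sub>v x2"
    using vec_first_last_append[of x0 k "n - k"] x0 k by (simp add: x1_def x2_def)
  have b_split: "b = A' *\<^sub>v x1 + A'' *\<^sub>v x2"
    using A_split[OF x1 x2] Ax0 x0_split by simp

  define d where "d = y - x1"
  have d: "d \<in> carrier_vec k" using y x1 by (simp add: d_def)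
  \<comment> \<open>\<open>M\<close> annihilates the part \<open>A'' *\<^sub>v x2\<close> of
    \<open>b\<close>.\<close>
  have "M *\<^sub>v b = M *\<^sub>v (A' *\<^sub>v x1)"
    unfolding b_split
    using mult_add_distrib_mat_vec[OF M, of "A' *\<^sub>v x1" "A'' *\<^sub>v x2"] A'c A2c x1 x2 M M2[OF x2]
    by simp
  then have "M *\<^sub>v (A' *\<^sub>v y) = M *\<^sub>v (A' *\<^sub>v x1)"
    using M_y assoc_mult_mat_vec[OF M A'c y] by simp
  then have MA'd: "M *\<^sub>v (A' *\<^sub>v d) = 0\<^sub>v k"
    using M A'c y x1 mult_minus_distrib_mat_vec[OF A'c y x1]
      mult_minus_distrib_mat_vec[OF M, of "A' *\<^sub>v y" "A' *\<^sub>v x1"]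
    by (simp add: d_def)

  interpret vec_space "TYPE('a)" n .
  have "set (cols C) \<subseteq> set (cols A)"
    using set_cols_cols_mat[of A "[0..<n]"] cols_mat_upt[OF A] pk k
    by (auto simp: C_def set_cols_cols_mat)
  then have "col_space C = col_space A"
    using col_space_eq_if_rank_eq[OF A Cc] rank_A'1_A'' r by (simp add: C_def)
  \<comment> \<open>Padding \<open>d\<close> with zeros writes \<open>A' *\<^sub>v d\<close> as a
    product with the whole of \<open>A\<close>, which puts it in the column space of
    \<open>A\<close> and so in that of \<open>C\<close>.\<close>
  moreover have "d @\<^sub>v 0\<^sub>v (n - k) \<in> carrier_vec n"
    using append_carrier_vec[OF d, of "0\<^sub>v (n - k)" "n - k"] k by simp
  then have "A *\<^sub>v (d @\<^sub>v 0\<^sub>v (n - k)) \<in> col_space A"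
    using A mult_mat_vec_carrier[OF A] by (auto simp: col_space_eq[OF A])
  moreover have "A *\<^sub>v (d @\<^sub>v 0\<^sub>v (n - k)) = A' *\<^sub>v d"
    using A_split[OF d] A2c A'c d by auto
  ultimately obtain z where z: "z \<in> carrier_vec (p + (n - k))" and Cz: "C *\<^sub>v z = A' *\<^sub>v d"
    using Cc by (auto simp: col_space_eq[OF Cc])
  \<comment> \<open>The coefficients \<open>z\<close> with respect to the columns of
    \<open>C\<close> are cut where \<open>A'1\<close> ends and \<open>A''\<close> begins.\<close>
  define u where "u = vec_first z p"
  define w where "w = vec_last z (n - k)"
  have u: "u \<in> carrier_vec p" and w: "w \<in> carrier_vec (n - k)"
    by (auto simp: u_def w_def)
  have A'd: "A' *\<^sub>v d = A'1 *\<^sub>v u + A'' *\<^sub>v w"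
    using C_split[OF u w] Cz vec_first_last_append[OF z] by (simp add: u_def w_def)
  have "(M * A'1) *\<^sub>v u = 0\<^sub>v k"
    using MA'd M2[OF w] mult_add_distrib_mat_vec[OF M, of "A'1 *\<^sub>v u" "A'' *\<^sub>v w"]
      assoc_mult_mat_vec[OF M A1c u] A1c A2c u w M
    by (simp add: A'd)
  \<comment> \<open>\<open>M * A'1\<close> has \<open>p\<close> columns and rank \<open>p\<close>.
    Its columns have length \<open>k\<close>, not \<open>n\<close>, so the kernel lemma is taken
    outside the interpreted space.\<close>
  then have "u = 0\<^sub>v p"
    using vec_space.full_rank_mult_vec_eq_0[of "M * A'1" k p u] M A1c u rank_M_A'1 rank_A'1
    by simp
  then have A'd_w: "A' *\<^sub>v d = A'' *\<^sub>v w"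
    using A'd A1c A2c w by auto

  let ?x = "y @\<^sub>v (x2 - w)"
  have y_eq: "y = x1 + d"
    using y x1 by (auto simp: d_def)
  have "A *\<^sub>v ?x = A' *\<^sub>v y + A'' *\<^sub>v (x2 - w)"
    using A_split y x2 w by simp
  \<comment> \<open>Expanding \<open>y\<close> as \<open>x1 + d\<close> and trading
    \<open>A' *\<^sub>v d\<close> for \<open>A'' *\<^sub>v w\<close> produces the term that cancels
    against the change in the last block.\<close>
  also have "\<dots> = (A' *\<^sub>v x1 + A'' *\<^sub>v w) + (A'' *\<^sub>v x2 - A'' *\<^sub>v w)"
    using mult_add_distrib_mat_vec[OF A'c x1 d] mult_minus_distrib_mat_vec[OF A2c x2 w]
    by (simp add: y_eq A'd_w)
  also have "\<dots> = b"
    unfolding b_split using A'c A2c x1 x2 w by (intro eq_vecI) auto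
  finally have "A *\<^sub>v ?x = b" .
  moreover have "?x \<in> carrier_vec n"
    using append_carrier_vec[OF y, of "x2 - w" "n - k"] x2 w k by simp
  moreover have "vec_first ?x k = y"
    using y by (intro eq_vecI) (auto simp: vec_first_def)
  ultimately show ?thesis by blast
qed

end
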